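(* Let $A\succ0$ be a $d\times d$ real symmetric matrix, $T\ge1$, and let $\{v_t\}_{t=1}^T$ be any $\mathbb{R}^d$-valued stochastic process with increments of finite covariance. Let $C_T=(I+A)^{-1}$ and $C_t^{-1}=2I+A-C_{t+1}$ for $1\le t\le T-1$. Then for every $t\in\{1,\dots,T\}$, the online optimal action $x_t$ at round $t$, given the previous action $x_{t-1}$, is $$x_t=C_tx_{t-1}+(I-C_t)v_t+\sum_{s=t+1}^{T}\left(\prod_{q=t}^{s-1}C_q\right)(I-C_s)\,\mathbb{E}[v_s-v_{s-1}\mid\mathcal{F}_t].$$
   Context: Smoothed online quadratic optimization: starting from a given deterministic $x_0\in\mathbb{R}^d$, at each round $t=1,\dots,T$ the vector $v_t\in\mathbb{R}^d$ is revealed and the player picks $x_t\in\mathbb{R}^d$, paying the hitting cost $f_t(x_t)=\frac12(x_t-v_t)^TA(x_t-v_t)$ and the switching cost $\frac12\|x_t-x_{t-1}\|_2^2$. $\mathcal{F}_t=\sigma(v_1,\dots,v_t)$ is the natural filtration; online algorithms choose $\mathcal{F}_t$-measurable $x_t$ and aim to minimize the expected total cost $\mathbb{E}\sum_{t=1}^T\left(f_t(x_t)+\frac12\|x_t-x_{t-1}\|_2^2\right)$. The online optimal action at round $t$ is the dynamic-programming one: with $V_{T+1}=0$ and the value function (minimum expected current and future online cost) $$V_t(x_{t-1},v_t)=\min_{x\in\mathbb{R}^d}\left\{f_t(x)+\tfrac12\|x-x_{t-1}\|_2^2+\mathbb{E}[V_{t+1}(x,v_{t+1})\mid\mathcal{F}_t]\right\},$$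 the online optimal $x_t$ is the minimizer on the right-hand side (for a general process, $V_t$ is understood as an $\mathcal{F}_t$-measurable random function of $x_{t-1}$). An empty sum is zero; the matrices $C_q$ commute. *)

theory Defs
  imports "HOL-Probability.Probability"
begin

definition pos_def_matrix :: "real^'n^'n \<Rightarrow> bool" where
  "pos_def_matrix A \<longleftrightarrow> transpose A = A \<and> (\<forall>x. x \<noteq> 0 \<longrightarrow> 0 < x \<bullet> (A *v x))"

definition natural_filtration :: "'w measure \<Rightarrow> (nat \<Rightarrow> 'w \<Rightarrow> real^'n) \<Rightarrow> nat \<Rightarrow> 'w measure" where
  "natural_filtration M v t =
     sigma (space M) (\<Union>s\<in>{1..t}. {v s -` B \<inter> space M | B. B \<in> sets borel})"

definition vec_cond_exp :: "'w measure \<Rightarrow> 'w measure \<Rightarrow> ('w \<Rightarrow> real^'n) \<Rightarrow> 'w \<Rightarrow> real^'n" where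
  "vec_cond_exp M F X \<omega> = (\<chi> i. real_cond_exp M F (\<lambda>\<omega>'. X \<omega>' $ i) \<omega>)"

definition hitting_cost :: "real^'n^'n \<Rightarrow> real^'n \<Rightarrow> real^'n \<Rightarrow> real" where
  "hitting_cost A v x = 1/2 * ((x - v) \<bullet> (A *v (x - v)))"

definition switching_cost :: "real^'n \<Rightarrow> real^'n \<Rightarrow> real" where
  "switching_cost x y = 1/2 * (norm (x - y))\<^sup>2"

text \<open>For each fixed \<open>x\<close>, the conditional expectation of \<open>Z x\<close> is only determined up to a null set
  depending on \<open>x\<close>. To minimise over \<open>x\<close> one needs a version \<open>W\<close> that is a random function
  of \<open>x\<close>; requiring almost surely continuous paths determines \<open>W\<close> up to indistinguishability.
  The random variables \<open>Z x\<close> used below are almost surely nonnegative, and they need not be integrable,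
  because \<open>v 1\<close> itself is not assumed integrable. For such variables \<^const>\<open>real_cond_exp\<close> is the
  (extended) conditional expectation wherever the latter is finite.\<close>

definition cond_exp_random_function ::
    "'w measure \<Rightarrow> 'w measure \<Rightarrow> (real^'n \<Rightarrow> 'w \<Rightarrow> real) \<Rightarrow> (real^'n \<Rightarrow> 'w \<Rightarrow> real) \<Rightarrow> bool" where
  "cond_exp_random_function M F Z W \<longleftrightarrow>
     (\<forall>x. W x \<in> borel_measurable F) \<and>
     (\<forall>x. AE \<omega> in M. W x \<omega> = real_cond_exp M F (Z x) \<omega>) \<and>
     (AE \<omega> in M. continuous_on UNIV (\<lambda>x. W x \<omega>))"

text \<open>The quantity minimised over \<open>x\<close> at round \<open>t\<close>, given the previous action \<open>y\<close>;
  \<open>W t x\<close> stands for the conditional expectation of \<open>V (t + 1) x\<close> given the information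
  at round \<open>t\<close>.\<close>

definition stage_objective ::
    "real^'n^'n \<Rightarrow> (nat \<Rightarrow> 'w \<Rightarrow> real^'n) \<Rightarrow> (nat \<Rightarrow> real^'n \<Rightarrow> 'w \<Rightarrow> real) \<Rightarrow>
     nat \<Rightarrow> real^'n \<Rightarrow> 'w \<Rightarrow> real^'n \<Rightarrow> real" where
  "stage_objective A v W t y \<omega> x =
     hitting_cost A (v t \<omega>) x + switching_cost x y + W t x \<omega>"

definition value_recursion ::
    "'w measure \<Rightarrow> real^'n^'n \<Rightarrow> nat \<Rightarrow> (nat \<Rightarrow> 'w \<Rightarrow> real^'n) \<Rightarrow>
     (nat \<Rightarrow> real^'n \<Rightarrow> 'w \<Rightarrow> real) \<Rightarrow> (nat \<Rightarrow> real^'n \<Rightarrow> 'w \<Rightarrow> real) \<Rightarrow> bool" where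
  "value_recursion M A T v V W \<longleftrightarrow>
     (\<forall>y \<omega>. V (T + 1) y \<omega> = 0) \<and>
     (\<forall>t\<in>{1..T}.
        cond_exp_random_function M (natural_filtration M v t) (V (t + 1)) (W t) \<and>
        (\<forall>y. V t y \<in> borel_measurable (natural_filtration M v t)) \<and>
        (AE \<omega> in M. \<forall>y. V t y \<omega> = (INF x. stage_objective A v W t y \<omega> x)))"

definition online_optimal_action ::
    "real^'n^'n \<Rightarrow> (nat \<Rightarrow> 'w \<Rightarrow> real^'n) \<Rightarrow> (nat \<Rightarrow> real^'n \<Rightarrow> 'w \<Rightarrow> real) \<Rightarrow>
     nat \<Rightarrow> real^'n \<Rightarrow> 'w \<Rightarrow> real^'n \<Rightarrow> bool" where
  "online_optimal_action A v W t y \<omega> X \<longleftrightarrow>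
     (\<forall>x. is_arg_min (stage_objective A v W t y \<omega>) (\<lambda>_. True) x \<longleftrightarrow> x = X)"

text \<open>The product of the matrices \<open>C q\<close> for \<open>a \<le> q < b\<close>. It is written out with \<open>(**)\<close> because
  the multiplication underlying \<^const>\<open>prod\<close> is componentwise on this type.\<close>

definition matrix_prod :: "(nat \<Rightarrow> real^'n^'n) \<Rightarrow> nat \<Rightarrow> nat \<Rightarrow> real^'n^'n" where
  "matrix_prod C a b = foldr (**) (map C [a..<b]) (mat 1)"

end

theory Submission
  imports Defs
begin

text \<open>Completing the square by backward induction on \<open>t\<close> shows that the value function is
  \<open>V t y = 1/2 * z \<bullet> (I - C t) z + z \<bullet> C t m + c\<close> with \<open>z = y - v t\<close>, where \<open>m\<close> and \<open>c\<close> do not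
  depend on \<open>y\<close>, and that the minimiser at round \<open>t\<close> is \<open>v t + C t (z - m)\<close>. The recursion for
  \<open>m\<close> is \<open>m t = E[C (t+1) m (t+1) - (I - C (t+1)) (v (t+1) - v t) | F t]\<close>, which the tower property
  solves in closed form. The increments are square integrable but \<open>v t\<close> itself need not be integrable;
  since \<open>y - v t\<close> is \<open>F t\<close>-measurable, it can still be taken out of the conditional expectation.
  Two continuous versions of the continuation value agree almost surely on a countable dense set,
  hence everywhere, so the minimisers are the same for every solution of the recursion.\<close>

section \<open>Positive definite quadratic forms\<close>

lemma inner_symmetric_matrix:
  fixes B :: "real^'n^'n"
  assumes "transpose B = B"
  shows "x \<bullet> (B *v y) = y \<bullet> (B *v x)"
  by (metis assms dot_lmul_matrix inner_commute transpose_matrix_vector)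

text \<open>If \<open>B *v x = 0\<close> then \<open>x \<bullet> (B *v x) = 0\<close>, so the kernel
  is trivial. As \<open>matrix_inv\<close> is a choice operator, invertibility has to be known
  before it satisfies any equation.\<close>

lemma pos_def_matrix_inv:
  fixes B :: "real^'n^'n"
  assumes "pos_def_matrix B"
  shows "B ** matrix_inv B = mat 1"
proof -
  have "x = 0" if "B *v x = 0" for x
    using assms that unfolding pos_def_matrix_def by (metis inner_zero_right less_irrefl)
  then have "invertible B"
    using invertible_left_inverse matrix_left_invertible_ker by blast
  then have "\<exists>B'. B ** B' = mat 1 \<and> B' ** B = mat 1"
    by (simp add: invertible_def)
  then have "B ** matrix_inv B = mat 1 \<and> matrix_inv B ** B = mat 1"
    unfolding matrix_inv_def by (rule someI_ex)
  then show ?thesis ..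
qed

lemma transpose_symmetric_inverse:
  fixes B C :: "real^'n^'n"
  assumes "transpose B = B" "B ** C = mat 1"
  shows "transpose C = C"
proof -
  have "transpose C ** B = mat 1"
    by (metis assms matrix_transpose_mul transpose_mat)
  then show ?thesis
    by (metis assms(2) matrix_mul_assoc matrix_mul_lid matrix_mul_rid)
qed

text \<open>Semidefiniteness is the invariant of the backward recursion, which starts from the zero
  matrix.\<close>

definition psd_matrix :: "real^'n^'n \<Rightarrow> bool" where
  "psd_matrix P \<longleftrightarrow> transpose P = P \<and> (\<forall>x. 0 \<le> x \<bullet> (P *v x))"

lemma transpose_add: "transpose (A + B) = transpose A + transpose (B :: real^'n^'m)"
  by (simp add: transpose_def vec_eq_iff)

lemma transpose_diff: "transpose (A - B) = transpose A - transpose (B :: real^'n^'m)"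
  by (simp add: transpose_def vec_eq_iff)

lemma uminus_matrix_vector_mult: "(- B) *v x = - (B *v (x :: real^'n))"
  using matrix_vector_mult_diff_rdistrib[of 0 B x] by simp

lemma pos_def_one_add:
  fixes A P :: "real^'n^'n"
  assumes "pos_def_matrix A" "psd_matrix P"
  shows "pos_def_matrix (mat 1 + A + P)"
  unfolding pos_def_matrix_def
proof (intro conjI allI impI)
  show "transpose (mat 1 + A + P) = mat 1 + A + P"
    using assms by (simp add: pos_def_matrix_def psd_matrix_def transpose_add transpose_mat)
next
  fix x :: "real^'n"
  assume "x \<noteq> 0"
  then have "0 < x \<bullet> (A *v x)" "0 \<le> x \<bullet> (P *v x)" "0 < x \<bullet> x"
    using assms by (auto simp: pos_def_matrix_def psd_matrix_def)
  then show "0 < x \<bullet> ((mat 1 + A + P) *v x)"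
    by (simp add: matrix_vector_mult_add_rdistrib inner_add_right del: inner_gt_zero_iff)
qed

text \<open>Substitute \<open>x = B y\<close> with \<open>B = mat 1 + A + P\<close>, so that
  \<open>y = C x\<close>. Since \<open>B\<close> dominates the identity,
  \<open>y \<bullet> y\<close> is at most \<open>x \<bullet> y\<close>; together with
  \<open>0 \<le> (x - y) \<bullet> (x - y)\<close> this bounds \<open>x \<bullet> y\<close> by
  \<open>x \<bullet> x\<close>.\<close>

lemma psd_one_minus_inverse:
  fixes A P C :: "real^'n^'n"
  assumes "pos_def_matrix A" "psd_matrix P" "(mat 1 + A + P) ** C = mat 1"
  shows "psd_matrix (mat 1 - C)"
  unfolding psd_matrix_def
proof (intro conjI allI)
  let ?B = "mat 1 + A + P"
  have B: "pos_def_matrix ?B"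
    using assms pos_def_one_add by blast
  show "transpose (mat 1 - C) = mat 1 - C"
    using transpose_symmetric_inverse[OF _ assms(3)] B
    by (simp add: pos_def_matrix_def transpose_diff transpose_mat)
  fix x
  define y where "y = C *v x"
  have x: "x = ?B *v y"
    by (simp add: y_def matrix_vector_mul_assoc assms(3))
  have "0 \<le> y \<bullet> (A *v y)" "0 \<le> y \<bullet> (P *v y)"
    using assms unfolding pos_def_matrix_def psd_matrix_def
    by (metis inner_zero_left order.refl order.strict_implies_order, blast)
  then have ge: "y \<bullet> y \<le> x \<bullet> y"
    by (simp add: x matrix_vector_mult_add_rdistrib inner_add_right inner_add_left inner_commute)
  have "0 \<le> (x - y) \<bullet> (x - y)"
    by simp
  with ge have "0 \<le> x \<bullet> x - x \<bullet> y"
    by (simp add: inner_diff_left inner_diff_right inner_commute)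
  then show "0 \<le> x \<bullet> ((mat 1 - C) *v x)"
    by (simp add: matrix_vector_mult_diff_rdistrib inner_diff_right y_def)
qed

text \<open>Here \<open>u = x - v t\<close> and \<open>z = y - v t\<close>. The left side is
  stationary where \<open>(mat 1 + A + P) *v u = z - m\<close>, that is at
  \<open>u = C *v (z - m)\<close>; the remainder on the right is the minimum, again quadratic in
  \<open>z\<close> with matrix \<open>mat 1 - C\<close>.\<close>

lemma complete_square:
  fixes A P C :: "real^'n^'n"
  assumes B: "transpose (mat 1 + A + P) = mat 1 + A + P" "(mat 1 + A + P) ** C = mat 1"
  shows "1/2 * (u \<bullet> (A *v u)) + 1/2 * (norm (u - z))\<^sup>2 + (1/2 * (u \<bullet> (P *v u)) + u \<bullet> m + k)
    = 1/2 * ((u - C *v (z - m)) \<bullet> ((mat 1 + A + P) *v (u - C *v (z - m))))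
      + (1/2 * (z \<bullet> ((mat 1 - C) *v z)) + z \<bullet> (C *v m) + (k - 1/2 * (m \<bullet> (C *v m))))"
proof -
  let ?B = "mat 1 + A + P"
  \<comment> \<open>The right-hand side of the first-order condition; eliminating \<open>z\<close>
    in its favour lets \<open>C\<close> cancel against \<open>mat 1 + A + P\<close>.\<close>
  define w where "w = z - m"
  have z: "z = w + m"
    by (simp add: w_def)
  have BC: "?B *v (C *v w) = w"
    by (simp add: matrix_vector_mul_assoc B)
  have s: "(C *v w) \<bullet> (?B *v u) = u \<bullet> w"
    using inner_symmetric_matrix[OF B(1), of "C *v w" u] BC by simp
  have sC: "m \<bullet> (C *v w) = w \<bullet> (C *v m)"
    by (rule inner_symmetric_matrix[OF transpose_symmetric_inverse[OF B]])
  have "(u - C *v w) \<bullet> (?B *v (u - C *v w)) = u \<bullet> (?B *v u) - 2 * (u \<bullet> w) + w \<bullet> (C *v w)"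
    by (simp add: matrix_vector_mult_diff_distrib inner_diff_left inner_diff_right BC s inner_commute)
  moreover have "u \<bullet> (?B *v u) = u \<bullet> u + u \<bullet> (A *v u) + u \<bullet> (P *v u)"
    by (simp add: matrix_vector_mult_add_rdistrib inner_add_right)
  ultimately show ?thesis
    unfolding w_def[symmetric] unfolding z
    using sC
    by (simp add: power2_norm_eq_inner inner_diff_left inner_diff_right inner_add_left inner_add_right
        matrix_vector_mult_diff_rdistrib matrix_vector_right_distrib inner_commute algebra_simps)
qed

text \<open>Moves the origin of the value of round \<open>t + 1\<close> from
  \<open>v (t + 1)\<close> to \<open>v t\<close>, with \<open>d\<close> the increment. The quadratic
  part in \<open>u\<close> keeps its coefficient; \<open>d\<close> enters only the linear
  coefficient and the constant.\<close>

lemma translate_quadratic: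
  fixes P C :: "real^'n^'n"
  assumes "transpose P = P"
  shows "1/2 * ((u - d) \<bullet> (P *v (u - d))) + (u - d) \<bullet> (C *v m) + (k - 1/2 * (m \<bullet> (C *v m)))
    = 1/2 * (u \<bullet> (P *v u)) + u \<bullet> (C *v m - P *v d)
      + ((1/2 * (d \<bullet> (P *v d)) - d \<bullet> (C *v m) - 1/2 * (m \<bullet> (C *v m))) + k)"
  using inner_symmetric_matrix[OF assms, of u d]
  by (simp add: inner_diff_left inner_diff_right matrix_vector_mult_diff_distrib)

lemma matrix_prod_same [simp]: "matrix_prod C a a = mat 1"
  by (simp add: matrix_prod_def)

lemma matrix_prod_step: "a < b \<Longrightarrow> matrix_prod C a b = C a ** matrix_prod C (Suc a) b"
  by (simp add: matrix_prod_def upt_conv_Cons)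

section \<open>Conditional expectation\<close>

text \<open>\<open>real_cond_exp\<close> is a difference of two nonnegative conditional
  expectations, and from each of these the indicator can be taken out whether or not
  \<open>f\<close> is integrable.\<close>

lemma (in sigma_finite_subalgebra) real_cond_exp_indicator:
  assumes [measurable]: "f \<in> borel_measurable M" "B \<in> sets F"
  shows "AE x in M. real_cond_exp M F (\<lambda>x. indicator B x * f x) x = indicator B x * real_cond_exp M F f x"
proof -
  have nn: "AE x in M. nn_cond_exp M F (\<lambda>x. ennreal (indicator B x * h x)) x
      = indicator B x * nn_cond_exp M F (\<lambda>x. ennreal (h x)) x"
    if [measurable]: "h \<in> borel_measurable M" for h :: "'a \<Rightarrow> real"
  proof -
    have "(\<lambda>x. ennreal (indicator B x * h x)) = (\<lambda>x. indicator B x * ennreal (h x))"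
      by (auto simp: indicator_def)
    then show ?thesis
      using nn_cond_exp_prod[of "indicator B" "\<lambda>x. ennreal (h x)"] by auto
  qed
  have "AE x in M. nn_cond_exp M F (\<lambda>x. ennreal (indicator B x * f x)) x
      = indicator B x * nn_cond_exp M F (\<lambda>x. ennreal (f x)) x"
    by (rule nn) simp
  moreover have "AE x in M. nn_cond_exp M F (\<lambda>x. ennreal (indicator B x * - f x)) x
      = indicator B x * nn_cond_exp M F (\<lambda>x. ennreal (- f x)) x"
    by (rule nn) simp
  ultimately show ?thesis
  proof eventually_elim
    case (elim x)
    then show ?case
      by (simp add: real_cond_exp_def indicator_def)
  qed
qed

lemma integrable_vec_nth:
  fixes X :: "'a \<Rightarrow> real^'n"
  assumes "integrable M X"
  shows "integrable M (\<lambda>x. X x $ i)"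
  by (rule integrable_bounded_linear[OF bounded_linear_vec_nth assms])

lemma borel_measurable_vec_iff:
  fixes X :: "'a \<Rightarrow> real^'n"
  shows "X \<in> borel_measurable M \<longleftrightarrow> (\<forall>i. (\<lambda>x. X x $ i) \<in> borel_measurable M)"
  by (subst borel_measurable_euclidean_space) (auto simp: Basis_vec_def inner_axis)

lemma borel_measurable_matrix_vector_mult [measurable (raw)]:
  fixes X :: "'a \<Rightarrow> real^'n" and K :: "real^'n^'m"
  assumes "X \<in> borel_measurable M"
  shows "(\<lambda>x. K *v X x) \<in> borel_measurable M"
  by (rule borel_measurable_continuous_on[OF matrix_vector_mult_linear_continuous_on assms])

lemma borel_measurable_vec_cond_exp [measurable]:
  "vec_cond_exp M F X \<in> borel_measurable F"
  by (simp add: borel_measurable_vec_iff vec_cond_exp_def)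

lemma AE_vec_eqI:
  fixes X Y :: "'a \<Rightarrow> real^'n"
  assumes "\<And>i. AE x in M. X x $ i = Y x $ i"
  shows "AE x in M. X x = Y x"
proof -
  have "AE x in M. \<forall>i\<in>UNIV. X x $ i = Y x $ i"
    by (rule AE_finite_allI) (simp_all add: assms)
  then show ?thesis
    by (simp add: vec_eq_iff)
qed

lemma (in sigma_finite_subalgebra) real_cond_exp_sum_on:
  fixes f :: "'b \<Rightarrow> 'a \<Rightarrow> real"
  assumes "\<And>i. i \<in> I \<Longrightarrow> integrable M (f i)"
  shows "AE x in M. real_cond_exp M F (\<lambda>x. \<Sum>i\<in>I. f i x) x = (\<Sum>i\<in>I. real_cond_exp M F (f i) x)"
proof -
  \<comment> \<open>Extended by zero outside \<open>I\<close>, the family is integrable at every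
    index.\<close>
  let ?f = "\<lambda>i x. if i \<in> I then f i x else 0"
  have "integrable M (?f i)" for i
    using assms by (cases "i \<in> I") auto
  from real_cond_exp_sum[where f = ?f and I = I, OF this]
  show ?thesis
    by (simp cong: sum.cong)
qed

lemma (in sigma_finite_subalgebra) vec_cond_exp_matrix_sum:
  fixes X :: "'b \<Rightarrow> 'a \<Rightarrow> real^'n" and K :: "'b \<Rightarrow> real^'n^'n"
  assumes "finite I" "\<And>i. i \<in> I \<Longrightarrow> integrable M (X i)"
  shows "AE x in M. vec_cond_exp M F (\<lambda>x. \<Sum>i\<in>I. K i *v X i x) x = (\<Sum>i\<in>I. K i *v vec_cond_exp M F (X i) x)"
proof (rule AE_vec_eqI)
  fix l
  let ?f = "\<lambda>p x. K (fst p) $ l $ snd p * X (fst p) x $ snd p"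
  have int: "integrable M (\<lambda>x. X i x $ j)" if "i \<in> I" for i j
    by (rule integrable_vec_nth[OF assms(2)[OF that]])
  \<comment> \<open>A coordinate of the sum is flattened to one real sum over pairs (summand,
    column), where scalar linearity applies.\<close>
  have comp: "(\<Sum>i\<in>I. K i *v Y i) $ l = (\<Sum>p\<in>I \<times> UNIV. K (fst p) $ l $ snd p * Y (fst p) $ snd p)"
    for Y :: "'b \<Rightarrow> real^'n"
    by (simp add: matrix_vector_mult_def sum.cartesian_product split_def)
  have "AE x in M. real_cond_exp M F (\<lambda>x. \<Sum>p\<in>I \<times> UNIV. ?f p x) x = (\<Sum>p\<in>I \<times> UNIV. real_cond_exp M F (?f p) x)"
    by (rule real_cond_exp_sum_on) (auto intro: int)
  moreover have "AE x in M. \<forall>p\<in>I \<times> UNIV.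
      real_cond_exp M F (?f p) x = K (fst p) $ l $ snd p * real_cond_exp M F (\<lambda>x. X (fst p) x $ snd p) x"
    using assms(1) by (intro AE_finite_allI) (auto intro!: real_cond_exp_cmult int)
  ultimately show "AE x in M. vec_cond_exp M F (\<lambda>x. \<Sum>i\<in>I. K i *v X i x) x $ l
      = (\<Sum>i\<in>I. K i *v vec_cond_exp M F (X i) x) $ l"
    unfolding comp
    by eventually_elim (simp only: vec_cond_exp_def vec_lambda_beta comp cong: sum.cong)
qed

lemma (in sigma_finite_subalgebra) vec_cond_exp_nested_subalg:
  fixes X :: "'a \<Rightarrow> real^'n"
  assumes "subalgebra M G" "subalgebra G F" "integrable M X"
  shows "AE x in M. vec_cond_exp M F (vec_cond_exp M G X) x = vec_cond_exp M F X x"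
proof (rule AE_vec_eqI)
  fix i
  show "AE x in M. vec_cond_exp M F (vec_cond_exp M G X) x $ i = vec_cond_exp M F X x $ i"
    using real_cond_exp_nested_subalg[OF assms(1,2) integrable_vec_nth[OF assms(3), of i]]
    by (simp add: vec_cond_exp_def)
qed

text \<open>No integrability is required of the \<open>F\<close>-measurable coefficients \<open>h\<close> and \<open>u\<close>:
  one may argue on the \<open>F\<close>-measurable events on which they are bounded by \<open>n\<close>.\<close>

lemma (in finite_measure_subalgebra) real_cond_exp_affine:
  fixes u G :: "'a \<Rightarrow> real^'n"
  assumes hF [measurable]: "h \<in> borel_measurable F" and uF: "u \<in> borel_measurable F"
    and G: "integrable M G" and k: "integrable M k"
  shows "AE x in M. real_cond_exp M F (\<lambda>x. h x + u x \<bullet> G x + k x) x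
     = h x + u x \<bullet> vec_cond_exp M F G x + real_cond_exp M F k x"
proof -
  have uiF [measurable]: "(\<lambda>x. u x $ i) \<in> borel_measurable F" for i
    using uF borel_measurable_vec_iff by blast
  have GM [measurable]: "(\<lambda>x. G x $ i) \<in> borel_measurable M" for i
    using integrable_vec_nth[OF G] by auto
  have kM [measurable]: "k \<in> borel_measurable M"
    using k by auto
  note toM = measurable_from_subalg[OF subalg]
  have hM [measurable]: "h \<in> borel_measurable M" and uM [measurable]: "(\<lambda>x. u x $ i) \<in> borel_measurable M" for i
    by (rule toM, simp)+
  \<comment> \<open>These events lie in \<open>F\<close>, bound both coefficients by
    \<open>n\<close>, and exhaust the space because \<open>h\<close> and \<open>u\<close> are finite
    everywhere.\<close>
  define B where "B n = {x \<in> space F. \<bar>h x\<bar> + (\<Sum>i\<in>UNIV. \<bar>u x $ i\<bar>) \<le> real n}" for n :: nat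
  have BF [measurable]: "B n \<in> sets F" for n
    unfolding B_def by measurable
  have BM [measurable]: "B n \<in> sets M" for n
    using BF subalg unfolding subalgebra_def by blast
  have hb: "\<bar>h x\<bar> \<le> real n" and ub: "\<bar>u x $ i\<bar> \<le> real n" if "x \<in> B n" for x n i
  proof -
    have "\<bar>u x $ i\<bar> \<le> (\<Sum>i\<in>UNIV. \<bar>u x $ i\<bar>)"
      by (rule member_le_sum) auto
    moreover have "0 \<le> (\<Sum>i\<in>UNIV. \<bar>u x $ i\<bar>)"
      by (simp add: sum_nonneg)
    ultimately show "\<bar>h x\<bar> \<le> real n" "\<bar>u x $ i\<bar> \<le> real n"
      using that unfolding B_def by auto
  qed
  let ?f = "\<lambda>x. h x + u x \<bullet> G x + k x"
  have fM [measurable]: "?f \<in> borel_measurable M"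
    unfolding inner_vec_def by simp
  \<comment> \<open>On the right the indicator makes every summand integrable, so linearity and
    taking out bounded factors apply. On the left it is taken out of \<open>?f\<close> itself by
    \<open>real_cond_exp_indicator\<close>.\<close>
  have "AE x in M. indicator (B n) x * real_cond_exp M F ?f x
     = indicator (B n) x * (h x + u x \<bullet> vec_cond_exp M F G x + real_cond_exp M F k x)" for n
  proof -
    let ?b = "indicator (B n) :: 'a \<Rightarrow> real"
    have ih: "integrable M (\<lambda>x. ?b x * h x)"
      by (rule integrable_const_bound[where B = "real n"]) (auto simp: indicator_def hb)
    have iu: "integrable M (\<lambda>x. (?b x * u x $ i) * G x $ i)" for i
    proof (rule Bochner_Integration.integrable_bound[where f = "\<lambda>x. real n * (G x $ i)"])
      show "integrable M (\<lambda>x. real n * (G x $ i))"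
        by (intro integrable_mult_right integrable_vec_nth G)
      show "AE x in M. norm ((?b x * u x $ i) * G x $ i) \<le> norm (real n * (G x $ i))"
        using ub by (auto simp: indicator_def abs_mult intro!: mult_right_mono)
    qed simp
    have ik: "integrable M (\<lambda>x. ?b x * k x)"
      using integrable_mult_indicator[OF BM k] by simp
    have eq: "(\<lambda>x. ?b x * ?f x) = (\<lambda>x. (?b x * h x + (\<Sum>i\<in>UNIV. (?b x * u x $ i) * G x $ i)) + ?b x * k x)"
      by (simp add: inner_vec_def algebra_simps sum_distrib_left)
    have "AE x in M. real_cond_exp M F (\<lambda>x. ?b x * ?f x) x
        = real_cond_exp M F (\<lambda>x. ?b x * h x + (\<Sum>i\<in>UNIV. (?b x * u x $ i) * G x $ i)) x
          + real_cond_exp M F (\<lambda>x. ?b x * k x) x"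
      unfolding eq by (intro real_cond_exp_add Bochner_Integration.integrable_add Bochner_Integration.integrable_sum ih iu ik)
    moreover have "AE x in M. real_cond_exp M F (\<lambda>x. ?b x * h x + (\<Sum>i\<in>UNIV. (?b x * u x $ i) * G x $ i)) x
        = real_cond_exp M F (\<lambda>x. ?b x * h x) x + real_cond_exp M F (\<lambda>x. \<Sum>i\<in>UNIV. (?b x * u x $ i) * G x $ i) x"
      by (intro real_cond_exp_add Bochner_Integration.integrable_sum ih iu)
    moreover have "AE x in M. real_cond_exp M F (\<lambda>x. ?b x * h x) x = ?b x * h x"
      by (intro real_cond_exp_F_meas ih) simp
    moreover have "AE x in M. real_cond_exp M F (\<lambda>x. \<Sum>i\<in>UNIV. (?b x * u x $ i) * G x $ i) x
        = (\<Sum>i\<in>UNIV. real_cond_exp M F (\<lambda>x. (?b x * u x $ i) * G x $ i) x)"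
      by (rule real_cond_exp_sum) (rule iu)
    moreover have "AE x in M. \<forall>i. real_cond_exp M F (\<lambda>x. (?b x * u x $ i) * G x $ i) x
        = (?b x * u x $ i) * real_cond_exp M F (\<lambda>x. G x $ i) x"
      by (intro AE_finite_allI[OF finite_class.finite_UNIV, simplified] real_cond_exp_mult iu) simp_all
    moreover have "AE x in M. real_cond_exp M F (\<lambda>x. ?b x * k x) x = ?b x * real_cond_exp M F k x"
      by (rule real_cond_exp_indicator) simp_all
    moreover have "AE x in M. real_cond_exp M F (\<lambda>x. ?b x * ?f x) x = ?b x * real_cond_exp M F ?f x"
      by (rule real_cond_exp_indicator) simp_all
    ultimately show ?thesis
      by eventually_elim
        (simp add: inner_vec_def vec_cond_exp_def algebra_simps sum_distrib_left)
  qed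
  \<comment> \<open>There are only countably many \<open>n\<close>, so a single null set serves them
    all.\<close>
  then have "AE x in M. \<forall>n. indicator (B n) x * real_cond_exp M F ?f x
     = indicator (B n) x * (h x + u x \<bullet> vec_cond_exp M F G x + real_cond_exp M F k x)"
    by (subst AE_all_countable) blast
  then show ?thesis
  proof (rule AE_mp, intro AE_I2 impI)
    fix x
    assume x: "x \<in> space M"
      and *: "\<forall>n. indicator (B n) x * real_cond_exp M F ?f x
        = indicator (B n) x * (h x + u x \<bullet> vec_cond_exp M F G x + real_cond_exp M F k x)"
    obtain n where "\<bar>h x\<bar> + (\<Sum>i\<in>UNIV. \<bar>u x $ i\<bar>) \<le> real n"
      using real_arch_simple by blast
    then have "x \<in> B n"
      using x subalg by (simp add: B_def subalgebra_def)
    then show "real_cond_exp M F ?f x = h x + u x \<bullet> vec_cond_exp M F G x + real_cond_exp M F k x"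
      using *[rule_format, of n] by simp
  qed
qed

section \<open>Square-integrable random vectors\<close>

text \<open>The class the increments belong to. It is stable under conditional expectation, and
  inner products of two members are integrable, as the constant terms of the value function
  require.\<close>

definition sq_integrable :: "'a measure \<Rightarrow> ('a \<Rightarrow> real^'n) \<Rightarrow> bool" where
  "sq_integrable M X \<longleftrightarrow> X \<in> borel_measurable M \<and> integrable M (\<lambda>x. (norm (X x))\<^sup>2)"

lemma sq_integrable_inner:
  assumes "sq_integrable M X" "sq_integrable M Y"
  shows "integrable M (\<lambda>x. X x \<bullet> Y x)"
proof (rule Bochner_Integration.integrable_bound)
  show "integrable M (\<lambda>x. (norm (X x))\<^sup>2 + (norm (Y x))\<^sup>2)"
    using assms by (simp add: sq_integrable_def)
  show "(\<lambda>x. X x \<bullet> Y x) \<in> borel_measurable M"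
    using assms by (auto simp: sq_integrable_def intro: borel_measurable_inner)
  show "AE x in M. norm (X x \<bullet> Y x) \<le> norm ((norm (X x))\<^sup>2 + (norm (Y x))\<^sup>2)"
  proof (rule AE_I2)
    fix x
    have "\<bar>X x \<bullet> Y x\<bar> \<le> norm (X x) * norm (Y x)"
      by (rule Cauchy_Schwarz_ineq2)
    also have "\<dots> \<le> (norm (X x))\<^sup>2 + (norm (Y x))\<^sup>2"
      using sum_squares_bound[of "norm (X x)" "norm (Y x)"]
        mult_nonneg_nonneg[OF norm_ge_zero[of "X x"] norm_ge_zero[of "Y x"]] by linarith
    finally show "norm (X x \<bullet> Y x) \<le> norm ((norm (X x))\<^sup>2 + (norm (Y x))\<^sup>2)"
      by simp
  qed
qed

lemma sq_integrable_add:
  assumes X: "sq_integrable M X" and Y: "sq_integrable M Y"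
  shows "sq_integrable M (\<lambda>x. X x + Y x)"
proof -
  have "integrable M (\<lambda>x. (norm (X x))\<^sup>2 + 2 * (X x \<bullet> Y x) + (norm (Y x))\<^sup>2)"
    using X Y sq_integrable_inner[OF X Y] by (simp add: sq_integrable_def)
  moreover have "(norm (X x + Y x))\<^sup>2 = (norm (X x))\<^sup>2 + 2 * (X x \<bullet> Y x) + (norm (Y x))\<^sup>2" for x
    by (simp add: power2_norm_eq_inner inner_add_left inner_add_right inner_commute)
  ultimately show ?thesis
    using X Y by (auto simp: sq_integrable_def intro: borel_measurable_add)
qed

lemma sq_integrable_matrix_vector_mult:
  fixes K :: "real^'n^'n"
  assumes "sq_integrable M X"
  shows "sq_integrable M (\<lambda>x. K *v X x)"
proof -
  have m [measurable]: "X \<in> borel_measurable M"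
    using assms by (simp add: sq_integrable_def)
  obtain b where b: "b > 0" "\<And>x. norm (K *v x) \<le> norm x * b"
    using bounded_linear.pos_bounded[OF matrix_vector_mul_bounded_linear[of K]] by blast
  have "integrable M (\<lambda>x. (norm (K *v X x))\<^sup>2)"
  proof (rule Bochner_Integration.integrable_bound)
    show "integrable M (\<lambda>x. (norm (X x))\<^sup>2 * b\<^sup>2)"
      using assms by (simp add: sq_integrable_def)
    show "AE x in M. norm ((norm (K *v X x))\<^sup>2) \<le> norm ((norm (X x))\<^sup>2 * b\<^sup>2)"
      using b by (auto simp flip: power_mult_distrib intro!: power_mono)
  qed simp
  then show ?thesis
    by (simp add: sq_integrable_def)
qed

lemma sq_integrable_zero: "sq_integrable M (\<lambda>x. 0)"
  by (simp add: sq_integrable_def)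

lemma sq_integrable_sum:
  assumes "\<And>i. i \<in> I \<Longrightarrow> sq_integrable M (X i)"
  shows "sq_integrable M (\<lambda>x. \<Sum>i\<in>I. X i x)"
  using assms
  by (induction I rule: infinite_finite_induct) (auto intro: sq_integrable_zero sq_integrable_add)

lemma sq_integrable_uminus: "sq_integrable M X \<Longrightarrow> sq_integrable M (\<lambda>x. - X x)"
  by (simp add: sq_integrable_def)

lemma (in finite_measure) sq_integrable_imp_integrable:
  assumes "sq_integrable M X"
  shows "integrable M X"
proof (rule Bochner_Integration.integrable_bound)
  show "integrable M (\<lambda>x. 1 + (norm (X x))\<^sup>2)"
    using assms by (simp add: sq_integrable_def)
  show "X \<in> borel_measurable M"
    using assms by (simp add: sq_integrable_def)
  have "r \<le> 1 + r\<^sup>2" for r :: real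
    using sum_squares_bound[of 1 r] zero_le_power2[of r] unfolding one_power2 mult_1_right by linarith
  then show "AE x in M. norm (X x) \<le> norm (1 + (norm (X x))\<^sup>2)"
    by (simp add: abs_of_nonneg)
qed

text \<open>Conditional Jensen for the convex function \<open>r\<^sup>2\<close>, coordinate by
  coordinate.\<close>

lemma (in finite_measure_subalgebra) sq_integrable_vec_cond_exp:
  assumes "sq_integrable M X"
  shows "sq_integrable M (vec_cond_exp M F X)"
proof -
  have X: "integrable M X"
    by (rule sq_integrable_imp_integrable[OF assms])
  have m [measurable]: "X \<in> borel_measurable M"
    using assms by (simp add: sq_integrable_def)
  have mi [measurable]: "(\<lambda>x. X x $ i) \<in> borel_measurable M" for i
    using m borel_measurable_vec_iff by blast
  have "integrable M (\<lambda>x. (real_cond_exp M F (\<lambda>x. X x $ i) x)\<^sup>2)" for i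
  proof (rule integrable_convex_cond_exp[where I = UNIV and q = "\<lambda>r. r\<^sup>2"])
    show "integrable M (\<lambda>x. X x $ i)"
      by (rule integrable_vec_nth[OF X])
    show "integrable M (\<lambda>x. (X x $ i)\<^sup>2)"
    proof (rule Bochner_Integration.integrable_bound)
      show "integrable M (\<lambda>x. (norm (X x))\<^sup>2)"
        using assms by (simp add: sq_integrable_def)
      show "AE x in M. norm ((X x $ i)\<^sup>2) \<le> norm ((norm (X x))\<^sup>2)"
        using component_le_norm_cart by (auto simp: abs_le_square_iff[symmetric])
    qed simp
    show "convex_on UNIV (\<lambda>r::real. r\<^sup>2)"
      by (rule convex_power2)
  qed auto
  moreover have "(norm (vec_cond_exp M F X x))\<^sup>2 = (\<Sum>i\<in>UNIV. (real_cond_exp M F (\<lambda>x. X x $ i) x)\<^sup>2)" for x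
    unfolding power2_norm_eq_inner by (simp add: inner_vec_def vec_cond_exp_def power2_eq_square)
  ultimately show ?thesis
    using measurable_from_subalg[OF subalg borel_measurable_vec_cond_exp]
    by (simp add: sq_integrable_def)
qed

section \<open>The dynamic program\<close>

locale smoothed_quadratic_optimization = prob_space M
  for M :: "'w measure" +
  fixes A :: "real^'n^'n"
    and T :: nat
    and v :: "nat \<Rightarrow> 'w \<Rightarrow> real^'n"
    and C :: "nat \<Rightarrow> real^'n^'n"
  assumes A_pos_def: "pos_def_matrix A"
    and v_measurable: "\<And>t. t \<in> {1..T} \<Longrightarrow> v t \<in> borel_measurable M"
    and increments: "\<And>t. t \<in> {2..T} \<Longrightarrow> integrable M (\<lambda>\<omega>. (norm (v t \<omega> - v (t - 1) \<omega>))\<^sup>2)"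
    and C_last: "C T = matrix_inv (mat 1 + A)"
    and C_step: "\<And>t. t \<in> {1..<T} \<Longrightarrow> C t = matrix_inv (2 *\<^sub>R mat 1 + A - C (t + 1))"
begin

text \<open>The Hessian of the value function of round \<open>t\<close> in the previous action. The
  value zero beyond \<open>T\<close> encodes the terminal condition and merges the two defining
  equations of \<open>C\<close> into the single formula \<open>C_eq\<close>.\<close>

definition P :: "nat \<Rightarrow> real^'n^'n" where
  "P t = (if t \<le> T then mat 1 - C t else 0)"

lemma C_eq:
  assumes "t \<in> {1..T}"
  shows "C t = matrix_inv (mat 1 + A + P (Suc t))"
proof (cases "t = T")
  case True
  then show ?thesis
    by (simp add: C_last P_def)
next
  case False
  with assms have "C t = matrix_inv (2 *\<^sub>R mat 1 + A - C (Suc t))" and t: "Suc t \<le> T"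
    using C_step[of t] by auto
  moreover have "2 *\<^sub>R mat 1 + A - C (Suc t) = mat 1 + A + P (Suc t)"
    using t by (simp add: P_def scaleR_2)
  ultimately show ?thesis
    by simp
qed

text \<open>Backward induction from the zero matrix at \<open>Suc T\<close>: semidefiniteness of
  \<open>P (Suc n)\<close> makes \<open>mat 1 + A + P (Suc n)\<close> invertible with inverse
  \<open>C n\<close>, and then \<open>psd_one_minus_inverse\<close> applies.\<close>

lemma P_psd:
  assumes "1 \<le> t" "t \<le> Suc T"
  shows "psd_matrix (P t)"
  using assms(2)
proof (induction rule: inc_induct)
  case base
  have "transpose (0 :: real^'n^'n) = 0"
    by (simp add: transpose_def vec_eq_iff)
  then show ?case
    by (simp add: P_def psd_matrix_def)
next
  case (step n)
  let ?B = "mat 1 + A + P (Suc n)"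
  have n: "n \<in> {1..T}"
    using step assms by auto
  have "?B ** C n = mat 1"
    unfolding C_eq[OF n] by (rule pos_def_matrix_inv[OF pos_def_one_add[OF A_pos_def step.IH]])
  then show ?case
    using psd_one_minus_inverse[OF A_pos_def step.IH] n by (simp add: P_def)
qed

lemma stage_matrix:
  assumes "t \<in> {1..T}"
  shows "pos_def_matrix (mat 1 + A + P (Suc t))" "(mat 1 + A + P (Suc t)) ** C t = mat 1"
proof -
  show "pos_def_matrix (mat 1 + A + P (Suc t))"
    using pos_def_one_add[OF A_pos_def P_psd] assms by simp
  then show "(mat 1 + A + P (Suc t)) ** C t = mat 1"
    unfolding C_eq[OF assms] by (rule pos_def_matrix_inv)
qed

section \<open>The natural filtration\<close>

abbreviation F :: "nat \<Rightarrow> 'w measure" where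
  "F \<equiv> natural_filtration M v"

lemma sets_F:
  "sets (F t) = sigma_sets (space M) (\<Union>s\<in>{1..t}. {v s -` B \<inter> space M | B. B \<in> sets borel})"
  unfolding natural_filtration_def by (rule sets_measure_of) auto

lemma space_F: "space (F t) = space M"
  unfolding natural_filtration_def by (rule space_measure_of) auto

lemma subalgebra_F:
  assumes "t \<le> T"
  shows "subalgebra M (F t)"
  unfolding subalgebra_def space_F sets_F
  using assms v_measurable
  by (auto intro!: sets.sigma_sets_subset measurable_sets)

lemma subalgebra_F_mono: "s \<le> t \<Longrightarrow> subalgebra (F t) (F s)"
  unfolding subalgebra_def space_F sets_F
  by (intro conjI refl sigma_sets_mono') force

lemma v_F_measurable: "s \<in> {1..t} \<Longrightarrow> v s \<in> borel_measurable (F t)"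
  unfolding measurable_def space_F sets_F
  by (force intro!: sigma_sets.Basic bexI[of _ s])

lemma finite_measure_subalgebra_F: "t \<le> T \<Longrightarrow> finite_measure_subalgebra M (F t)"
  by unfold_locales (rule subalgebra_F)

section \<open>Increments and the explicit value function\<close>

definition incr :: "nat \<Rightarrow> 'w \<Rightarrow> real^'n" where
  "incr s \<omega> = v s \<omega> - v (s - 1) \<omega>"

lemma sq_integrable_incr:
  assumes "s \<in> {2..T}"
  shows "sq_integrable M (incr s)"
proof -
  have [measurable]: "v s \<in> borel_measurable M" "v (s - 1) \<in> borel_measurable M"
    using assms by (auto intro!: v_measurable)
  have "incr s \<in> borel_measurable M"
    unfolding incr_def[abs_def] by (rule borel_measurable_diff) measurable
  then show ?thesis
    using increments[OF assms] by (simp add: sq_integrable_def incr_def)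
qed

text \<open>The weight of the increment of round \<open>s\<close> in the optimal action of round
  \<open>t\<close>. The drift of round \<open>t\<close> uses \<open>K (Suc t)\<close>, because the
  minimiser contributes the factor \<open>C t\<close>.\<close>

definition K :: "nat \<Rightarrow> nat \<Rightarrow> real^'n^'n" where
  "K t s = matrix_prod C t s ** (mat 1 - C s)"

text \<open>The value function is quadratic in the previous action, measured relative to the current target
  \<open>v t\<close>; \<open>drift\<close> and \<open>offset\<close> are the coefficients of the linear and of the constant term of the
  continuation value.\<close>

definition drift :: "nat \<Rightarrow> 'w \<Rightarrow> real^'n" where
  "drift t \<omega> = - (\<Sum>s\<in>{t+1..T}. K (Suc t) s *v vec_cond_exp M (F t) (incr s) \<omega>)"

text \<open>The constant that round \<open>s\<close> adds: the last term comes from completing the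
  square, the others from moving the origin from \<open>v s\<close> to \<open>v (s - 1)\<close> as
  in \<open>translate_quadratic\<close>.\<close>

definition offset_incr :: "nat \<Rightarrow> 'w \<Rightarrow> real" where
  "offset_incr s \<omega> = 1/2 * (incr s \<omega> \<bullet> (P s *v incr s \<omega>)) - incr s \<omega> \<bullet> (C s *v drift s \<omega>)
     - 1/2 * (drift s \<omega> \<bullet> (C s *v drift s \<omega>))"

definition offset :: "nat \<Rightarrow> 'w \<Rightarrow> real" where
  "offset t \<omega> = (\<Sum>s\<in>{t+1..T}. real_cond_exp M (F t) (offset_incr s) \<omega>)"

definition val :: "nat \<Rightarrow> real^'n \<Rightarrow> 'w \<Rightarrow> real" where
  "val t y \<omega> = (if t \<le> T then
     1/2 * ((y - v t \<omega>) \<bullet> ((mat 1 - C t) *v (y - v t \<omega>))) + (y - v t \<omega>) \<bullet> (C t *v drift t \<omega>)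
     + (offset t \<omega> - 1/2 * (drift t \<omega> \<bullet> (C t *v drift t \<omega>))) else 0)"

text \<open>The candidate for \<open>W t\<close>: a polynomial in \<open>x\<close> for each outcome,
  hence a version with continuous paths.\<close>

definition cont_val :: "nat \<Rightarrow> real^'n \<Rightarrow> 'w \<Rightarrow> real" where
  "cont_val t x \<omega> =
     1/2 * ((x - v t \<omega>) \<bullet> (P (Suc t) *v (x - v t \<omega>))) + (x - v t \<omega>) \<bullet> drift t \<omega> + offset t \<omega>"

section \<open>Measurability and integrability of the coefficients\<close>

lemma drift_measurable [measurable]: "drift t \<in> borel_measurable (F t)"
  unfolding drift_def[abs_def] by measurable

lemma offset_measurable [measurable]: "offset t \<in> borel_measurable (F t)"
  unfolding offset_def[abs_def] by measurable

lemma val_measurable: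
  assumes "t \<in> {1..T}"
  shows "val t y \<in> borel_measurable (F t)"
proof -
  have [measurable]: "v t \<in> borel_measurable (F t)"
    using assms by (intro v_F_measurable) auto
  show ?thesis
    unfolding val_def[abs_def] by measurable
qed

lemma cont_val_measurable:
  assumes "t \<in> {1..T}"
  shows "cont_val t x \<in> borel_measurable (F t)"
proof -
  have [measurable]: "v t \<in> borel_measurable (F t)"
    using assms by (intro v_F_measurable) auto
  show ?thesis
    unfolding cont_val_def[abs_def] by measurable
qed

lemma continuous_cont_val: "continuous_on UNIV (\<lambda>x. cont_val t x \<omega>)"
  unfolding cont_val_def
  by (intro continuous_intros continuous_on_compose2[OF matrix_vector_mult_linear_continuous_on[of UNIV]]) auto

lemma sq_integrable_drift:
  assumes "t \<in> {1..T}"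
  shows "sq_integrable M (drift t)"
proof -
  interpret finite_measure_subalgebra M "F t"
    using assms by (intro finite_measure_subalgebra_F) auto
  show ?thesis
    unfolding drift_def[abs_def]
    using assms
    by (intro sq_integrable_uminus sq_integrable_sum sq_integrable_matrix_vector_mult
        sq_integrable_vec_cond_exp sq_integrable_incr) auto
qed

lemma integrable_offset_incr:
  assumes "s \<in> {2..T}"
  shows "integrable M (offset_incr s)"
  unfolding offset_incr_def[abs_def]
  using assms
  by (intro Bochner_Integration.integrable_diff integrable_mult_right sq_integrable_inner
      sq_integrable_matrix_vector_mult sq_integrable_incr sq_integrable_drift) auto

section \<open>Conditional expectation of the next value\<close>

lemma atLeastAtMost_split: "t < T \<Longrightarrow> {t+1..T} = insert (Suc t) {Suc t + 1..T}"
  by auto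

text \<open>The term of round \<open>t + 1\<close> in \<open>drift t\<close> comes from
  \<open>- P (Suc t) *v incr (Suc t)\<close>. The later ones come from
  \<open>C (Suc t) *v drift (Suc t)\<close>, whose factor \<open>C (Suc t)\<close> prolongs each
  matrix product, while the tower property coarsens \<open>F (Suc t)\<close> to
  \<open>F t\<close>.\<close>

lemma cond_exp_drift:
  assumes "1 \<le> t" "t < T"
  shows "AE \<omega> in M. vec_cond_exp M (F t)
      (\<lambda>\<omega>. C (Suc t) *v drift (Suc t) \<omega> - P (Suc t) *v incr (Suc t) \<omega>) \<omega> = drift t \<omega>"
proof -
  interpret finite_measure_subalgebra M "F t"
    using assms by (intro finite_measure_subalgebra_F) auto
  interpret S: finite_measure_subalgebra M "F (Suc t)"
    using assms by (intro finite_measure_subalgebra_F) auto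
  \<comment> \<open>The increments as known after round \<open>t + 1\<close>: the first exactly, the
    later ones through their conditional expectations.\<close>
  define Y where "Y s = (if s = Suc t then incr s else vec_cond_exp M (F (Suc t)) (incr s))" for s
  have incr: "sq_integrable M (incr s)" if "s \<in> {t+1..T}" for s
    using that assms by (intro sq_integrable_incr) auto
  have Y_int: "integrable M (Y s)" if "s \<in> {t+1..T}" for s
    using incr[OF that] unfolding Y_def
    by (auto intro: sq_integrable_imp_integrable S.sq_integrable_vec_cond_exp)
  have Y_ce: "AE \<omega> in M. vec_cond_exp M (F t) (Y s) \<omega> = vec_cond_exp M (F t) (incr s) \<omega>"
    if "s \<in> {t+1..T}" for s
  proof (cases "s = Suc t")
    case False
    have "AE \<omega> in M. vec_cond_exp M (F t) (vec_cond_exp M (F (Suc t)) (incr s)) \<omega> = vec_cond_exp M (F t) (incr s) \<omega>"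
      by (rule vec_cond_exp_nested_subalg[OF S.subalg subalgebra_F_mono sq_integrable_imp_integrable[OF incr[OF that]]]) simp
    with False show ?thesis
      by (simp add: Y_def)
  qed (simp add: Y_def)
  have K1: "K (Suc t) (Suc t) = P (Suc t)"
    using assms by (simp add: K_def P_def)
  have K2: "K (Suc t) s = C (Suc t) ** K (Suc (Suc t)) s" if "s \<in> {Suc t + 1..T}" for s
    using that by (simp add: K_def matrix_prod_step matrix_mul_assoc)
  have "C (Suc t) *v drift (Suc t) \<omega> - P (Suc t) *v incr (Suc t) \<omega>
      = (\<Sum>s\<in>{t+1..T}. (- K (Suc t) s) *v Y s \<omega>)" for \<omega>
  proof -
    have "(\<Sum>s\<in>{t+1..T}. K (Suc t) s *v Y s \<omega>)
        = P (Suc t) *v incr (Suc t) \<omega> + (\<Sum>s\<in>{Suc t + 1..T}. K (Suc t) s *v Y s \<omega>)"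
      unfolding atLeastAtMost_split[OF assms(2)] by (subst sum.insert) (auto simp: K1 Y_def)
    also have "(\<Sum>s\<in>{Suc t + 1..T}. K (Suc t) s *v Y s \<omega>) = - (C (Suc t) *v drift (Suc t) \<omega>)"
      unfolding drift_def linear_neg[OF matrix_vector_mul_linear] linear_sum[OF matrix_vector_mul_linear] minus_minus
      by (rule sum.cong) (auto simp: K2 Y_def matrix_vector_mul_assoc)
    finally show ?thesis
      by (simp add: sum_negf uminus_matrix_vector_mult)
  qed
  then have eq: "(\<lambda>\<omega>. C (Suc t) *v drift (Suc t) \<omega> - P (Suc t) *v incr (Suc t) \<omega>)
      = (\<lambda>\<omega>. \<Sum>s\<in>{t+1..T}. (- K (Suc t) s) *v Y s \<omega>)"
    by blast
  have "AE \<omega> in M. vec_cond_exp M (F t) (\<lambda>\<omega>. \<Sum>s\<in>{t+1..T}. (- K (Suc t) s) *v Y s \<omega>) \<omega>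
      = (\<Sum>s\<in>{t+1..T}. (- K (Suc t) s) *v vec_cond_exp M (F t) (Y s) \<omega>)"
    by (rule vec_cond_exp_matrix_sum) (auto intro: Y_int)
  moreover have "AE \<omega> in M. \<forall>s\<in>{t+1..T}. vec_cond_exp M (F t) (Y s) \<omega> = vec_cond_exp M (F t) (incr s) \<omega>"
    by (rule AE_finite_allI) (auto intro: Y_ce)
  ultimately show ?thesis
    unfolding eq
    by eventually_elim (simp add: drift_def sum_negf uminus_matrix_vector_mult)
qed

text \<open>The same splitting and tower argument for the constants. Integrability is recorded
  because \<open>real_cond_exp_affine\<close> asks for it.\<close>

lemma cond_exp_offset:
  assumes "1 \<le> t" "t < T"
  shows "integrable M (\<lambda>\<omega>. offset_incr (Suc t) \<omega> + offset (Suc t) \<omega>)"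
    and "AE \<omega> in M. real_cond_exp M (F t) (\<lambda>\<omega>. offset_incr (Suc t) \<omega> + offset (Suc t) \<omega>) \<omega> = offset t \<omega>"
proof -
  interpret finite_measure_subalgebra M "F t"
    using assms by (intro finite_measure_subalgebra_F) auto
  interpret S: finite_measure_subalgebra M "F (Suc t)"
    using assms by (intro finite_measure_subalgebra_F) auto
  define Y where "Y s = (if s = Suc t then offset_incr s else real_cond_exp M (F (Suc t)) (offset_incr s))" for s
  have int: "integrable M (offset_incr s)" if "s \<in> {t+1..T}" for s
    using that assms by (intro integrable_offset_incr) auto
  have Y_int: "integrable M (Y s)" if "s \<in> {t+1..T}" for s
    using int[OF that] by (auto simp: Y_def intro: S.real_cond_exp_int(1))
  have Y_ce: "AE \<omega> in M. real_cond_exp M (F t) (Y s) \<omega> = real_cond_exp M (F t) (offset_incr s) \<omega>"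
    if "s \<in> {t+1..T}" for s
  proof (cases "s = Suc t")
    case False
    have "AE \<omega> in M. real_cond_exp M (F t) (real_cond_exp M (F (Suc t)) (offset_incr s)) \<omega> = real_cond_exp M (F t) (offset_incr s) \<omega>"
      by (rule real_cond_exp_nested_subalg[OF S.subalg subalgebra_F_mono int[OF that]]) simp
    with False show ?thesis
      by (simp add: Y_def)
  qed (simp add: Y_def)
  have "offset_incr (Suc t) \<omega> + offset (Suc t) \<omega> = (\<Sum>s\<in>{t+1..T}. Y s \<omega>)" for \<omega>
    unfolding atLeastAtMost_split[OF assms(2)] offset_def by (subst sum.insert) (auto simp: Y_def intro!: sum.cong)
  then have eq: "(\<lambda>\<omega>. offset_incr (Suc t) \<omega> + offset (Suc t) \<omega>) = (\<lambda>\<omega>. \<Sum>s\<in>{t+1..T}. Y s \<omega>)"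
    by blast
  show "integrable M (\<lambda>\<omega>. offset_incr (Suc t) \<omega> + offset (Suc t) \<omega>)"
    unfolding eq by (intro Bochner_Integration.integrable_sum Y_int)
  have "AE \<omega> in M. real_cond_exp M (F t) (\<lambda>\<omega>. \<Sum>s\<in>{t+1..T}. Y s \<omega>) \<omega>
      = (\<Sum>s\<in>{t+1..T}. real_cond_exp M (F t) (Y s) \<omega>)"
    by (rule real_cond_exp_sum_on) (rule Y_int)
  moreover have "AE \<omega> in M. \<forall>s\<in>{t+1..T}. real_cond_exp M (F t) (Y s) \<omega> = real_cond_exp M (F t) (offset_incr s) \<omega>"
    by (rule AE_finite_allI) (auto intro: Y_ce)
  ultimately show "AE \<omega> in M. real_cond_exp M (F t) (\<lambda>\<omega>. offset_incr (Suc t) \<omega> + offset (Suc t) \<omega>) \<omega> = offset t \<omega>"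
    unfolding eq by eventually_elim (simp add: offset_def)
qed

text \<open>Written around \<open>v t\<close>, the next value has an \<open>F t\<close>-measurable
  quadratic part, a linear part with \<open>F t\<close>-measurable factor \<open>x - v t\<close> and
  integrable coefficient, and an integrable constant. This is the shape handled by
  \<open>real_cond_exp_affine\<close>.\<close>

lemma cond_exp_val:
  assumes "t \<in> {1..T}"
  shows "AE \<omega> in M. real_cond_exp M (F t) (val (Suc t) x) \<omega> = cont_val t x \<omega>"
proof -
  interpret finite_measure_subalgebra M "F t"
    using assms by (intro finite_measure_subalgebra_F) auto
  show ?thesis
  proof (cases "t = T")
    case True
    \<comment> \<open>In the last round both sides vanish: \<open>val (Suc T)\<close> and
      \<open>P (Suc T)\<close> are zero by definition, and \<open>drift T\<close> and
      \<open>offset T\<close> are empty sums.\<close>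
    have "AE \<omega> in M. real_cond_exp M (F t) (\<lambda>_. 0) \<omega> = 0"
      by (rule real_cond_exp_F_meas) auto
    then show ?thesis
      using True by (simp add: val_def[abs_def] cont_val_def P_def drift_def offset_def)
  next
    case False
    with assms have t: "1 \<le> t" "t < T"
      by auto
    let ?u = "\<lambda>\<omega>. x - v t \<omega>"
    let ?h = "\<lambda>\<omega>. 1/2 * (?u \<omega> \<bullet> (P (Suc t) *v ?u \<omega>))"
    let ?G = "\<lambda>\<omega>. C (Suc t) *v drift (Suc t) \<omega> - P (Suc t) *v incr (Suc t) \<omega>"
    let ?k = "\<lambda>\<omega>. offset_incr (Suc t) \<omega> + offset (Suc t) \<omega>"
    have P: "transpose (P (Suc t)) = P (Suc t)" "P (Suc t) = mat 1 - C (Suc t)"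
      using P_psd[of "Suc t"] t by (auto simp: psd_matrix_def P_def)
    have "val (Suc t) x \<omega> = ?h \<omega> + ?u \<omega> \<bullet> ?G \<omega> + ?k \<omega>" for \<omega>
    proof -
      have "x - v (Suc t) \<omega> = ?u \<omega> - incr (Suc t) \<omega>"
        by (simp add: incr_def)
      then show ?thesis
        using t translate_quadratic[OF P(1), of "?u \<omega>" "incr (Suc t) \<omega>" "C (Suc t)" "drift (Suc t) \<omega>" "offset (Suc t) \<omega>"]
        by (simp only: val_def offset_incr_def P(2)[symmetric] Suc_leI if_True)
    qed
    then have eq: "val (Suc t) x = (\<lambda>\<omega>. ?h \<omega> + ?u \<omega> \<bullet> ?G \<omega> + ?k \<omega>)"
      by blast
    have [measurable]: "v t \<in> borel_measurable (F t)"
      using assms by (intro v_F_measurable) auto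
    have "sq_integrable M (\<lambda>\<omega>. C (Suc t) *v drift (Suc t) \<omega> + - (P (Suc t) *v incr (Suc t) \<omega>))"
      using t
      by (intro sq_integrable_add sq_integrable_uminus sq_integrable_matrix_vector_mult sq_integrable_drift sq_integrable_incr) auto
    then have G: "integrable M ?G"
      using sq_integrable_imp_integrable by simp
    have "AE \<omega> in M. real_cond_exp M (F t) (\<lambda>\<omega>. ?h \<omega> + ?u \<omega> \<bullet> ?G \<omega> + ?k \<omega>) \<omega>
      = ?h \<omega> + ?u \<omega> \<bullet> vec_cond_exp M (F t) ?G \<omega> + real_cond_exp M (F t) ?k \<omega>"
      by (rule real_cond_exp_affine[OF _ _ G cond_exp_offset(1)[OF t]]) measurable
    then show ?thesis
      unfolding eq using cond_exp_drift[OF t] cond_exp_offset(2)[OF t]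
      by eventually_elim (simp add: cont_val_def)
  qed
qed

section \<open>Minimisation of the stage objective\<close>

lemma stage_objective_square:
  assumes "t \<in> {1..T}" "W t x \<omega> = cont_val t x \<omega>"
  shows "stage_objective A v W t y \<omega> x =
    1/2 * ((x - v t \<omega> - C t *v (y - v t \<omega> - drift t \<omega>)) \<bullet>
      ((mat 1 + A + P (Suc t)) *v (x - v t \<omega> - C t *v (y - v t \<omega> - drift t \<omega>)))) + val t y \<omega>"
proof -
  have "norm (x - y) = norm ((x - v t \<omega>) - (y - v t \<omega>))"
    by simp
  then show ?thesis
    using assms complete_square[of A "P (Suc t)" "C t" "x - v t \<omega>" "y - v t \<omega>" "drift t \<omega>" "offset t \<omega>"]
      stage_matrix[of t]
    by (simp add: stage_objective_def hitting_cost_def switching_cost_def cont_val_def val_def pos_def_matrix_def)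
qed

text \<open>For a fixed outcome the objective exceeds \<open>val t y \<omega>\<close> by a positive
  definite form in the distance to one point, so the infimum is attained there and only
  there.\<close>

lemma stage_objective_min:
  assumes t: "t \<in> {1..T}" and W: "\<And>x. W t x \<omega> = cont_val t x \<omega>"
  shows "(INF x. stage_objective A v W t y \<omega> x) = val t y \<omega>"
    and "online_optimal_action A v W t y \<omega> (v t \<omega> + C t *v (y - v t \<omega> - drift t \<omega>))"
proof -
  let ?B = "mat 1 + A + P (Suc t)"
  let ?X = "v t \<omega> + C t *v (y - v t \<omega> - drift t \<omega>)"
  let ?f = "stage_objective A v W t y \<omega>"
  have f: "?f x = 1/2 * ((x - ?X) \<bullet> (?B *v (x - ?X))) + val t y \<omega>" for x
    using stage_objective_square[of t W x \<omega> y, OF t W] by (simp add: diff_diff_eq)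
  have fX: "?f ?X = val t y \<omega>"
    by (simp add: f)
  have lt: "?f ?X < ?f x" if "x \<noteq> ?X" for x
    using that stage_matrix(1)[OF t] unfolding fX f pos_def_matrix_def by simp
  then have le: "?f ?X \<le> ?f x" for x
    by (cases "x = ?X") (auto intro: less_imp_le)
  show "(INF x. ?f x) = val t y \<omega>"
    unfolding fX[symmetric] by (rule cInf_eq_minimum) (use le in auto)
  show "online_optimal_action A v W t y \<omega> ?X"
    unfolding online_optimal_action_def is_arg_min_def
    using lt le by (metis linorder_not_less)
qed

text \<open>Multiplying the negated drift by \<open>C t\<close> completes each product
  \<open>matrix_prod C (Suc t) s\<close> to \<open>matrix_prod C t s\<close>.\<close>

lemma minimizer_eq:
  assumes "t \<in> {1..T}"
  shows "v t \<omega> + C t *v (y - v t \<omega> - drift t \<omega>) = C t *v y + (mat 1 - C t) *v v t \<omega> +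
     (\<Sum>s\<in>{t+1..T}. (matrix_prod C t s ** (mat 1 - C s)) *v
        vec_cond_exp M (F t) (\<lambda>\<omega>'. v s \<omega>' - v (s - 1) \<omega>') \<omega>)"
proof -
  have "(\<Sum>s\<in>{t+1..T}. (matrix_prod C t s ** (mat 1 - C s)) *v
        vec_cond_exp M (F t) (\<lambda>\<omega>'. v s \<omega>' - v (s - 1) \<omega>') \<omega>)
      = (\<Sum>s\<in>{t+1..T}. C t *v (K (Suc t) s *v vec_cond_exp M (F t) (incr s) \<omega>))"
    by (rule sum.cong)
      (auto simp: K_def incr_def[abs_def] matrix_prod_step matrix_vector_mul_assoc matrix_mul_assoc)
  also have "\<dots> = - (C t *v drift t \<omega>)"
    by (simp add: drift_def linear_neg[OF matrix_vector_mul_linear] linear_sum[OF matrix_vector_mul_linear])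
  finally show ?thesis
    by (simp add: matrix_vector_mult_diff_distrib matrix_vector_mult_diff_rdistrib)
qed

section \<open>Existence and uniqueness of the solution of the recursion\<close>

lemma value_recursion_val: "value_recursion M A T v val cont_val"
  unfolding value_recursion_def cond_exp_random_function_def
proof (intro conjI allI ballI)
  show "val (T + 1) y \<omega> = 0" for y \<omega>
    by (simp add: val_def)
next
  fix t x
  assume t: "t \<in> {1..T}"
  show "cont_val t x \<in> borel_measurable (F t)" "val t x \<in> borel_measurable (F t)"
    using t by (rule cont_val_measurable, rule val_measurable)
  show "AE \<omega> in M. cont_val t x \<omega> = real_cond_exp M (F t) (val (t + 1) x) \<omega>"
    using cond_exp_val[OF t, of x] by (simp add: eq_commute)
  show "AE \<omega> in M. \<forall>y. val t y \<omega> = (INF x. stage_objective A v cont_val t y \<omega> x)"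
    using stage_objective_min(1)[OF t] by simp
qed (simp add: continuous_cont_val)

text \<open>For each fixed \<open>x\<close> both sides are versions of the same conditional
  expectation, but with a null set depending on \<open>x\<close>. Countable density and path
  continuity remove that dependence.\<close>

lemma continuation_unique:
  assumes VW: "value_recursion M A T v V W" and t: "t \<in> {1..T}"
    and V: "AE \<omega> in M. \<forall>y. V (Suc t) y \<omega> = val (Suc t) y \<omega>"
  shows "AE \<omega> in M. \<forall>x. W t x \<omega> = cont_val t x \<omega>"
proof -
  interpret finite_measure_subalgebra M "F t"
    using t by (intro finite_measure_subalgebra_F) auto
  \<comment> \<open>Needed for \<open>real_cond_exp_cong\<close>, and stated for an arbitrary
    solution so that it covers both \<open>V\<close> and \<open>val\<close>. In the last round the
    terminal condition supplies measurability.\<close>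
  have meas: "Z (Suc t) x \<in> borel_measurable M" if "value_recursion M A T v Z W'" for Z W' x
  proof (cases "Suc t \<le> T")
    case True
    then have "Z (Suc t) x \<in> borel_measurable (F (Suc t))"
      using that by (simp add: value_recursion_def)
    then show ?thesis
      by (rule measurable_from_subalg[OF subalgebra_F[OF True]])
  next
    case False
    with t have "Suc t = T + 1"
      by simp
    then have "Z (Suc t) x = (\<lambda>_. 0)"
      using that by (simp add: value_recursion_def fun_eq_iff)
    then show ?thesis
      by simp
  qed
  have W: "AE \<omega> in M. W t x \<omega> = cont_val t x \<omega>" for x
  proof -
    have "AE \<omega> in M. V (Suc t) x \<omega> = val (Suc t) x \<omega>"
      using V by eventually_elim simp
    then have "AE \<omega> in M. real_cond_exp M (F t) (V (Suc t) x) \<omega> = real_cond_exp M (F t) (val (Suc t) x) \<omega>"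
      by (rule real_cond_exp_cong) (rule meas[OF VW], rule meas[OF value_recursion_val])
    moreover have "AE \<omega> in M. W t x \<omega> = real_cond_exp M (F t) (V (Suc t) x) \<omega>"
      using VW t by (simp add: value_recursion_def cond_exp_random_function_def)
    ultimately show ?thesis
      using cond_exp_val[OF t] by eventually_elim simp
  qed
  obtain D :: "(real^'n) set" where D: "countable D" "\<And>X. open X \<Longrightarrow> X \<noteq> {} \<Longrightarrow> \<exists>d\<in>D. d \<in> X"
    using countable_dense_setE by blast
  have "AE \<omega> in M. \<forall>x\<in>D. W t x \<omega> = cont_val t x \<omega>"
    using W D(1) by (simp add: AE_ball_countable)
  moreover have "AE \<omega> in M. continuous_on UNIV (\<lambda>x. W t x \<omega>)"
    using VW t by (simp add: value_recursion_def cond_exp_random_function_def)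
  ultimately show ?thesis
  proof eventually_elim
    case (elim \<omega>)
    let ?N = "{x. W t x \<omega> \<noteq> cont_val t x \<omega>}"
    \<comment> \<open>The set of disagreement is open and misses the dense set \<open>D\<close>, so
      it is empty.\<close>
    have "open ?N"
      using elim(2) continuous_cont_val by (intro open_Collect_neq) auto
    then have "?N = {}"
      using D(2)[of ?N] elim(1) by blast
    then show ?case
      by blast
  qed
qed

text \<open>Backward induction from the terminal condition at \<open>Suc T\<close>: the next value
  determines the continuation value, which in turn determines the infimum defining the present
  one.\<close>

lemma value_unique:
  assumes VW: "value_recursion M A T v V W" and t: "1 \<le> t" "t \<le> Suc T"
  shows "AE \<omega> in M. \<forall>y. V t y \<omega> = val t y \<omega>"
  using t(2)
proof (induction rule: inc_induct)
  case base
  show ?case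
    using VW by (simp add: value_recursion_def val_def)
next
  case (step n)
  then have n: "n \<in> {1..T}"
    using t by auto
  have "AE \<omega> in M. \<forall>y. V n y \<omega> = (INF x. stage_objective A v W n y \<omega> x)"
    using VW n by (simp add: value_recursion_def)
  with continuation_unique[OF VW n step.IH] show ?case
    by eventually_elim (simp add: stage_objective_min(1)[OF n])
qed

lemma optimal_action:
  assumes VW: "value_recursion M A T v V W" and t: "t \<in> {1..T}"
  shows "AE \<omega> in M. \<forall>y. online_optimal_action A v W t y \<omega>
     (C t *v y + (mat 1 - C t) *v v t \<omega> +
      (\<Sum>s\<in>{t+1..T}. (matrix_prod C t s ** (mat 1 - C s)) *v
         vec_cond_exp M (F t) (\<lambda>\<omega>'. v s \<omega>' - v (s - 1) \<omega>') \<omega>))"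
proof -
  have "AE \<omega> in M. \<forall>x. W t x \<omega> = cont_val t x \<omega>"
    using t by (intro continuation_unique[OF VW t] value_unique[OF VW]) auto
  then show ?thesis
    unfolding minimizer_eq[OF t, symmetric]
    by eventually_elim (simp add: stage_objective_min(2)[OF t])
qed

end

theorem theorem3p2:
  fixes M :: "'w measure"
    and A :: "real^'n^'n"
    and T :: nat
    and v :: "nat \<Rightarrow> 'w \<Rightarrow> real^'n"
    and C :: "nat \<Rightarrow> real^'n^'n"
  assumes "prob_space M"
    and "pos_def_matrix A"
    and "T \<ge> 1"
    and "\<And>t. t \<in> {1..T} \<Longrightarrow> v t \<in> borel_measurable M"
    and "\<And>t. t \<in> {2..T} \<Longrightarrow> integrable M (\<lambda>\<omega>. (norm (v t \<omega> - v (t - 1) \<omega>))\<^sup>2)"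
    and "C T = matrix_inv (mat 1 + A)"
    and "\<And>t. t \<in> {1..<T} \<Longrightarrow> C t = matrix_inv (2 *\<^sub>R mat 1 + A - C (t + 1))"
  shows "(\<exists>V W. value_recursion M A T v V W) \<and>
    (\<forall>V W. value_recursion M A T v V W \<longrightarrow>
      (\<forall>t\<in>{1..T}. AE \<omega> in M. \<forall>y.
        online_optimal_action A v W t y \<omega>
          (C t *v y + (mat 1 - C t) *v v t \<omega> +
           (\<Sum>s\<in>{t+1..T}. (matrix_prod C t s ** (mat 1 - C s)) *v
              vec_cond_exp M (natural_filtration M v t) (\<lambda>\<omega>'. v s \<omega>' - v (s - 1) \<omega>') \<omega>))))"
proof -
  interpret prob_space M
    by (rule assms(1))
  interpret smoothed_quadratic_optimization M A T v C
    by unfold_locales (rule assms(2), rule assms(4), assumption, rule assms(5), assumption,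
        rule assms(6), rule assms(7), assumption)
  show ?thesis
    \<comment> \<open>The pair \<open>val\<close>, \<open>cont_val\<close> witnesses existence, so
      the claim about all solutions is not vacuous.\<close>
    using value_recursion_val optimal_action by blast
qed

end
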